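(* Let $B\ge 1$, let $x_{\rm tr}\in\mathbb{C}^B\setminus\{0\}$ be a fixed training vector, let $\sigma_x^2,\sigma_w^2>0$, let $a,b>0$ be the constants associated with the digital modulation used, and let $h$ be a complex random variable (the fading coefficient of a flat-fading AWGN channel) with known prior distribution, $E[h]=0$ and $0<E[|h|^2]<\infty$. Then the MMSE filter $$f_{\rm MMSE}=\frac{E[|h|^2]\,x_{\rm tr}}{E[|h|^2]\,\|x_{\rm tr}\|^2+\sigma_w^2}$$ is not optimal for the task of minimizing the average zeroth order error probability $\overline{[P_e]}_0(f)=E_h\big[[P_e]_0(f;h)\big]$; that is, $f_{\rm MMSE}$ does not minimize $\overline{[P_e]}_0$ over $f\in\mathbb{C}^B\setminus\{0\}$.
   Context: A linear channel estimator is determined by a filter $f\in\mathbb{C}^B$ through $\hat h=f^Hy_{\rm tr}$, where $y_{\rm tr}=h\,x_{\rm tr}+w_{\rm tr}$ and $w_{\rm tr}\in\mathbb{C}^B$ has i.i.d. circularly symmetric complex Gaussian entries of mean $0$ and variance $\sigma_w^2$; data symbols have mean zero and power $\sigma_x^2$. For common modulations, the error probability in an AWGN channel is approximately $aQ(b\sqrt{\mathrm{SNR}})$, where $a,b>0$ depend on the constellation geometry and $Q(x)=\frac{1}{\sqrt{2\pi}}\int_x^{\infty}e^{-t^2/2}\,dt$. The zeroth order error probability for channel value $h$ is defined as $$[P_e]_0(f;h)=a\,Q\!\left(b\sqrt{\frac{|h|^2|f^Hx_{\rm tr}|^2+\sigma_w^2\|f\|^2}{\sigma_w^2/\sigma_x^2+|h|^2|f^Hx_{\rm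 tr}-1|^2+\sigma_w^2\|f\|^2}}\right).$$ $E_h$ denotes expectation over the prior distribution of $h$ (the same prior that appears in $f_{\rm MMSE}$); the filter $f$ does not depend on the realization of $h$. *)

theory Defs
  imports "HOL-Probability.Probability"
begin

text \<open>The inner product \<open>f\<^sup>H x\<close>, conjugate-linear in its first argument. (The library's
  inner product on \<open>complex ^ 'n\<close> is the real part of this.)\<close>
definition herm_prod :: "complex ^ 'n \<Rightarrow> complex ^ 'n \<Rightarrow> complex" where
  "herm_prod f x = (\<Sum>i\<in>UNIV. cnj (f $ i) * x $ i)"

definition Q_fun :: "real \<Rightarrow> real" where
  "Q_fun x = 1 / sqrt (2 * pi) * (LINT t:{x..}|lborel. exp (- t\<^sup>2 / 2))"

text \<open>The numbers \<open>\<sigma>x\<close>, \<open>\<sigma>w\<close> are standard deviations: the data power is \<open>\<sigma>x\<^sup>2\<close> and the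
  noise variance is \<open>\<sigma>w\<^sup>2\<close>.\<close>
definition zeroth_error_prob ::
  "real \<Rightarrow> real \<Rightarrow> real \<Rightarrow> real \<Rightarrow> complex ^ 'n \<Rightarrow> complex ^ 'n \<Rightarrow> complex \<Rightarrow> real" where
  "zeroth_error_prob a b \<sigma>x \<sigma>w xtr f h =
     a * Q_fun (b * sqrt
       (((cmod h)\<^sup>2 * (cmod (herm_prod f xtr))\<^sup>2 + \<sigma>w\<^sup>2 * (norm f)\<^sup>2) /
        (\<sigma>w\<^sup>2 / \<sigma>x\<^sup>2 + (cmod h)\<^sup>2 * (cmod (herm_prod f xtr - 1))\<^sup>2 + \<sigma>w\<^sup>2 * (norm f)\<^sup>2)))"

text \<open>For \<open>\<sigma>x, \<sigma>w \<noteq> 0\<close> and \<open>h\<close> a random variable, the integrand is bounded and measurable,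
  so the Bochner integral is the genuine expectation and not its default value.\<close>
definition avg_zeroth_error_prob ::
  "'w measure \<Rightarrow> ('w \<Rightarrow> complex) \<Rightarrow> real \<Rightarrow> real \<Rightarrow> real \<Rightarrow> real \<Rightarrow>
     complex ^ 'n \<Rightarrow> complex ^ 'n \<Rightarrow> real" where
  "avg_zeroth_error_prob M h a b \<sigma>x \<sigma>w xtr f =
     (\<integral>\<omega>. zeroth_error_prob a b \<sigma>x \<sigma>w xtr f (h \<omega>) \<partial>M)"

definition mmse_filter ::
  "'w measure \<Rightarrow> ('w \<Rightarrow> complex) \<Rightarrow> real \<Rightarrow> complex ^ 'n \<Rightarrow> complex ^ 'n" where
  "mmse_filter M h \<sigma>w xtr =
     (let m = (\<integral>\<omega>. (cmod (h \<omega>))\<^sup>2 \<partial>M)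
      in (m / (m * (norm xtr)\<^sup>2 + \<sigma>w\<^sup>2)) *\<^sub>R xtr)"

end

theory Submission
  imports Defs
begin

text \<open>Along the ray \<open>f = (u / \<parallel>x\<^sub>t\<^sub>r\<parallel>\<^sup>2) x\<^sub>t\<^sub>r\<close> with \<open>u > 0\<close>, put \<open>v = 1 / u\<close>,
  \<open>c = \<sigma>w\<^sup>2 / \<parallel>x\<^sub>t\<^sub>r\<parallel>\<^sup>2\<close> and \<open>r = \<sigma>w\<^sup>2 / \<sigma>x\<^sup>2\<close>. The effective SNR is then
  \<open>(|h|\<^sup>2 + c) / (r v\<^sup>2 + |h|\<^sup>2 (1 - v)\<^sup>2 + c)\<close>, which for every value of \<open>h\<close> is strictly
  decreasing in \<open>v \<ge> 1\<close>. The MMSE filter shrinks, i.e. it has \<open>u < 1\<close>, so the unbiased filter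
  \<open>u = 1\<close> has a strictly smaller error probability for every channel value, hence on average.\<close>

lemma Q_fun_eq: "Q_fun x = (LINT t|lborel. indicator {x..} t * std_normal_density t)"
proof -
  have "Q_fun x = (LINT t|lborel. 1 / sqrt (2 * pi) * (indicator {x..} t * exp (- t\<^sup>2 / 2)))"
    unfolding Q_fun_def set_lebesgue_integral_def
    by (subst Bochner_Integration.integral_mult_right_zero) (simp add: mult.commute)
  also have "\<dots> = (LINT t|lborel. indicator {x..} t * std_normal_density t)"
    by (intro Bochner_Integration.integral_cong) (auto simp: std_normal_density_def)
  finally show ?thesis .
qed

lemma integrable_indicator_std_normal:
  assumes "A \<in> sets borel"
  shows "integrable lborel (\<lambda>t. indicator A t * std_normal_density t)"
  using integrable_mult_indicator[of A lborel std_normal_density] assms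
  by simp

text \<open>The two tails differ by the Gaussian integral over \<open>{x..<y}\<close>. The integrand
  is positive there and the interval has positive length, so this integral cannot vanish.\<close>

lemma Q_fun_strict_antimono:
  assumes "x < y"
  shows "Q_fun y < Q_fun x"
proof -
  let ?g = "\<lambda>t. indicator {x..<y} t * std_normal_density t"
  have "Q_fun x = (LINT t|lborel. indicator {y..} t * std_normal_density t + ?g t)"
    unfolding Q_fun_eq using assms
    by (intro Bochner_Integration.integral_cong) (auto simp: indicator_def)
  then have "Q_fun x = Q_fun y + (LINT t|lborel. ?g t)"
    by (simp add: Q_fun_eq integrable_indicator_std_normal)
  moreover have "(LINT t|lborel. ?g t) \<noteq> 0"
  proof
    assume "(LINT t|lborel. ?g t) = 0"
    then have "AE t in lborel. ?g t = 0"
      by (subst (asm) integral_nonneg_eq_0_iff_AE) (auto simp: integrable_indicator_std_normal)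
    moreover have "?g t = 0 \<Longrightarrow> t \<notin> {x..<y}" for t
      using normal_density_pos[of 1 0 t] by auto
    ultimately have "AE t in lborel. t \<notin> {x..<y}"
      by (rule eventually_mono)
    then have "{x..<y} \<in> null_sets lborel"
      by (subst AE_iff_null_sets) auto
    then show False
      using assms by (simp add: null_sets_def)
  qed
  moreover have "0 \<le> (LINT t|lborel. ?g t)"
    by (intro integral_nonneg_AE) auto
  ultimately show ?thesis by linarith
qed

text \<open>Supplies the constant bound \<open>\<bar>a\<bar>\<close> that makes the error
  probability integrable over a probability space.\<close>

lemma Q_fun_bounds: "\<bar>Q_fun x\<bar> \<le> 1"
proof -
  have "Q_fun x \<le> (LINT t|lborel. std_normal_density t)"
    unfolding Q_fun_eq
    by (intro integral_mono integrable_indicator_std_normal)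
      (auto simp: indicator_def)
  moreover have "0 \<le> Q_fun x"
    unfolding Q_fun_eq by (intro integral_nonneg_AE) auto
  ultimately show ?thesis
    by simp
qed

lemma borel_measurable_Q_fun [measurable]: "Q_fun \<in> borel_measurable borel"
proof -
  \<comment> \<open>Measurability comes from monotonicity; the sign is flipped because
    \<open>Q_fun\<close> is decreasing.\<close>
  have "mono (\<lambda>x. - Q_fun x)"
    by (rule monoI) (metis Q_fun_strict_antimono le_less neg_le_iff_le)
  then have "(\<lambda>x. - (- Q_fun x)) \<in> borel_measurable borel"
    by (intro borel_measurable_uminus borel_measurable_mono)
  then show ?thesis by simp
qed

lemma integrable_zeroth_error_prob:
  assumes "prob_space M" "h \<in> borel_measurable M"
  shows "integrable M (\<lambda>\<omega>. zeroth_error_prob a b \<sigma>x \<sigma>w xtr f (h \<omega>))"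
proof -
  interpret prob_space M by fact
  note [measurable] = assms(2)
  show ?thesis
  proof (rule integrable_const_bound[where B = "\<bar>a\<bar>"])
    show "AE \<omega> in M. norm (zeroth_error_prob a b \<sigma>x \<sigma>w xtr f (h \<omega>)) \<le> \<bar>a\<bar>"
      unfolding zeroth_error_prob_def
      by (simp add: abs_mult mult_left_le Q_fun_bounds)
    show "(\<lambda>\<omega>. zeroth_error_prob a b \<sigma>x \<sigma>w xtr f (h \<omega>)) \<in> borel_measurable M"
      unfolding zeroth_error_prob_def by measurable
  qed
qed

lemma herm_prod_scaleR_self: "herm_prod (t *\<^sub>R x) x = of_real (t * (norm x)\<^sup>2)"
proof -
  have "(norm x)\<^sup>2 = (\<Sum>i\<in>UNIV. (cmod (x $ i))\<^sup>2)"
    by (simp add: norm_vec_def L2_set_def sum_nonneg)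
  moreover have "cnj (x $ i) * x $ i = of_real ((cmod (x $ i))\<^sup>2)" for i
    by (simp add: complex_norm_square mult.commute del: of_real_power)
  moreover have "herm_prod (t *\<^sub>R x) x = (\<Sum>i\<in>UNIV. of_real t * (cnj (x $ i) * x $ i))"
    unfolding herm_prod_def
    by (intro sum.cong) (simp_all add: scaleR_conv_of_real[where 'a = complex])
  ultimately show ?thesis
    by (simp add: sum_distrib_left del: of_real_power)
qed

text \<open>Dividing by the squared norm makes \<open>herm_prod f xtr\<close> equal to
  \<open>u\<close>, so the ray is parametrized by the gain of the estimator on the true channel, and
  \<open>u = 1\<close> is the unbiased filter.\<close>

lemma zeroth_error_prob_ray:
  assumes "xtr \<noteq> 0"
  shows "zeroth_error_prob a b \<sigma>x \<sigma>w xtr ((u / (norm xtr)\<^sup>2) *\<^sub>R xtr) z =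
    a * Q_fun (b * sqrt (u\<^sup>2 * ((cmod z)\<^sup>2 + \<sigma>w\<^sup>2 / (norm xtr)\<^sup>2) /
      (\<sigma>w\<^sup>2 / \<sigma>x\<^sup>2 + (cmod z)\<^sup>2 * (u - 1)\<^sup>2 + \<sigma>w\<^sup>2 / (norm xtr)\<^sup>2 * u\<^sup>2)))"
proof -
  have H: "herm_prod ((u / (norm xtr)\<^sup>2) *\<^sub>R xtr) xtr = of_real u"
    using assms by (simp add: herm_prod_scaleR_self)
  have H1: "cmod (of_real u - 1) = \<bar>u - 1\<bar>"
    by (metis norm_of_real of_real_1 of_real_diff)
  have N: "\<sigma>w\<^sup>2 * (norm ((u / (norm xtr)\<^sup>2) *\<^sub>R xtr))\<^sup>2 = \<sigma>w\<^sup>2 / (norm xtr)\<^sup>2 * u\<^sup>2"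
    using assms by (simp add: field_simps power2_eq_square)
  show ?thesis
    unfolding zeroth_error_prob_def H N H1 by (simp add: algebra_simps)
qed

text \<open>Cross-multiplying and cancelling the positive factor \<open>g + c\<close> and the common
  term \<open>c * u\<^sup>2\<close> leaves \<open>u\<^sup>2 * r < r + g * (u - 1)\<^sup>2\<close>.
  Strictness comes from \<open>r > 0\<close>, so it survives at \<open>g = 0\<close>, that is, when
  the channel value is zero.\<close>

lemma snr_less_unbiased:
  fixes g c r u :: real
  assumes "g \<ge> 0" "c > 0" "r > 0" "0 < u" "u < 1"
  shows "u\<^sup>2 * (g + c) / (r + g * (u - 1)\<^sup>2 + c * u\<^sup>2) < (g + c) / (r + c)"
proof -
  have "u\<^sup>2 < 1"
    using assms by (simp add: power_less_one_iff)
  then have "u\<^sup>2 * r < r"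
    using assms by simp
  moreover have "0 \<le> g * (u - 1)\<^sup>2"
    using assms by simp
  ultimately have "u\<^sup>2 * (r + c) < r + g * (u - 1)\<^sup>2 + c * u\<^sup>2"
    by (simp add: algebra_simps)
  then have "(g + c) * (u\<^sup>2 * (r + c)) < (g + c) * (r + g * (u - 1)\<^sup>2 + c * u\<^sup>2)"
    using assms by simp
  moreover have "0 < r + g * (u - 1)\<^sup>2 + c * u\<^sup>2"
    using assms by (simp add: add_pos_nonneg)
  ultimately show ?thesis
    using assms by (simp add: divide_less_eq less_divide_eq mult_ac)
qed

lemma zeroth_error_prob_unbiased_less:
  assumes "xtr \<noteq> 0" "\<sigma>x\<^sup>2 > 0" "\<sigma>w\<^sup>2 > 0" "a > 0" "b > 0" "0 < u" "u < 1"
  shows "zeroth_error_prob a b \<sigma>x \<sigma>w xtr ((1 / (norm xtr)\<^sup>2) *\<^sub>R xtr) z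
    < zeroth_error_prob a b \<sigma>x \<sigma>w xtr ((u / (norm xtr)\<^sup>2) *\<^sub>R xtr) z"
proof -
  have "u\<^sup>2 * ((cmod z)\<^sup>2 + \<sigma>w\<^sup>2 / (norm xtr)\<^sup>2) /
      (\<sigma>w\<^sup>2 / \<sigma>x\<^sup>2 + (cmod z)\<^sup>2 * (u - 1)\<^sup>2 + \<sigma>w\<^sup>2 / (norm xtr)\<^sup>2 * u\<^sup>2)
    < ((cmod z)\<^sup>2 + \<sigma>w\<^sup>2 / (norm xtr)\<^sup>2) / (\<sigma>w\<^sup>2 / \<sigma>x\<^sup>2 + \<sigma>w\<^sup>2 / (norm xtr)\<^sup>2)"
    by (rule snr_less_unbiased) (use assms in auto)
  then show ?thesis
    unfolding zeroth_error_prob_ray[OF assms(1)]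
    using assms by (intro mult_strict_left_mono Q_fun_strict_antimono) auto
qed

theorem proposition7:
  fixes M :: "'w measure" and h :: "'w \<Rightarrow> complex"
    and xtr :: "complex ^ 'n" and a b \<sigma>x \<sigma>w :: real
  assumes "prob_space M"
    and "h \<in> borel_measurable M"
    and "integrable M (\<lambda>\<omega>. (cmod (h \<omega>))\<^sup>2)"
    and "(\<integral>\<omega>. h \<omega> \<partial>M) = 0"
    and "(\<integral>\<omega>. (cmod (h \<omega>))\<^sup>2 \<partial>M) > 0"
    and "xtr \<noteq> 0"
    and "\<sigma>x\<^sup>2 > 0" and "\<sigma>w\<^sup>2 > 0"
    and "a > 0" and "b > 0"
  shows "\<not> (\<forall>f :: complex ^ 'n. f \<noteq> 0 \<longrightarrow>
           avg_zeroth_error_prob M h a b \<sigma>x \<sigma>w xtr (mmse_filter M h \<sigma>w xtr)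
             \<le> avg_zeroth_error_prob M h a b \<sigma>x \<sigma>w xtr f)"
proof -
  interpret prob_space M by fact
  define m where "m = (\<integral>\<omega>. (cmod (h \<omega>))\<^sup>2 \<partial>M)"
  \<comment> \<open>The value of \<open>herm_prod f xtr\<close> at the MMSE filter. It lies strictly
    below 1 because of the noise variance in the denominator.\<close>
  define u where "u = m * (norm xtr)\<^sup>2 / (m * (norm xtr)\<^sup>2 + \<sigma>w\<^sup>2)"
  define f where "f = (1 / (norm xtr)\<^sup>2) *\<^sub>R xtr"
  have pos: "m * (norm xtr)\<^sup>2 > 0"
    using assms by (simp add: m_def)
  have u: "0 < u" "u < 1"
    using divide_pos_pos[of "m * (norm xtr)\<^sup>2" "m * (norm xtr)\<^sup>2 + \<sigma>w\<^sup>2"]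
      divide_less_eq_1_pos[of "m * (norm xtr)\<^sup>2 + \<sigma>w\<^sup>2" "m * (norm xtr)\<^sup>2"] pos assms(8)
    unfolding u_def by linarith+
  have mmse: "mmse_filter M h \<sigma>w xtr = (u / (norm xtr)\<^sup>2) *\<^sub>R xtr"
    using assms(6) by (simp add: mmse_filter_def Let_def u_def flip: m_def)
  \<comment> \<open>The strict inequality holds at every sample point; with both sides integrable
    and the space of total mass 1, it passes to the expectations.\<close>
  have "avg_zeroth_error_prob M h a b \<sigma>x \<sigma>w xtr f
      < avg_zeroth_error_prob M h a b \<sigma>x \<sigma>w xtr (mmse_filter M h \<sigma>w xtr)"
    unfolding avg_zeroth_error_prob_def mmse f_def
    by (intro integral_less_AE_space integrable_zeroth_error_prob assms AE_I2
          zeroth_error_prob_unbiased_less u) (simp add: emeasure_space_1)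
  moreover have "f \<noteq> 0"
    using assms(6) by (simp add: f_def)
  ultimately show ?thesis
    by (meson not_le)
qed

end
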